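(* Let $n,d\ge 1$ be integers and $r=\binom{n+d}{n}-1$. Fix $q=[f]\in\mathbb{P}^r=\mathbb{P}(\mathbb{C}[z_0,\dots,z_n]_d)$ and take a finite set $S\subset\mathbb{P}^n$ such that $\nu_d(S)$ minimally spans $q$. Assume that $|S|<\binom{n+\lfloor d/2\rfloor}{n}$ and that $S$ gives $|S|$ independent conditions to $\mathbb{C}[z_0,\dots,z_n]_{\lfloor d/2\rfloor}$. Take any $A\subset\mathbb{P}^n$ such that $|A|=|S|$ and $A$ induces an additive decomposition of $f$, i.e. $q\in\langle\nu_d(A)\rangle$. Let $H^0(\mathcal{I}_A(\lfloor d/2\rfloor))$ (resp. $H^0(\mathcal{I}_S(\lfloor d/2\rfloor))$) denote the linear subspace of $\mathbb{C}[z_0,\dots,z_n]_{\lfloor d/2\rfloor}$ formed by the polynomials vanishing at all $p\in A$ (resp. all $p\in S$). Then $$H^0(\mathcal{I}_A(\lfloor d/2\rfloor))=H^0(\mathcal{I}_S(\lfloor d/2\rfloor)).$$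
   Context: $\mathbb{C}[z_0,\dots,z_n]_t$ is the complex vector space of homogeneous polynomials of degree $t$ in $z_0,\dots,z_n$. $\mathbb{P}^n:=\mathbb{P}(\mathbb{C}[z_0,\dots,z_n]_1)$, so a point of $\mathbb{P}^n$ is the class $[\ell]$ of a non-zero linear form $\ell=a_0z_0+\cdots+a_nz_n$ up to a non-zero scalar; it has homogeneous coordinates $[a_0:\dots:a_n]$, and forms in $\mathbb{C}[z_0,\dots,z_n]_t$ are evaluated at it via $(a_0,\dots,a_n)$. $\nu_d:\mathbb{P}^n\to\mathbb{P}^r$ is the order $d$ Veronese embedding $[\ell]\mapsto[\ell^d]$. $\langle\ \rangle$ denotes projective linear span. For a finite set $S\subset\mathbb{P}^n$, $\nu_d(S)$ minimally spans $q$ if $q\in\langle\nu_d(S)\rangle$ and $q\notin\langle\nu_d(S')\rangle$ for every $S'\subsetneq S$. An additive decomposition of a non-zero $f\in\mathbb{C}[z_0,\dots,z_n]_d$ is an expression $f=\sum\ell_i^d$ as a finite sum of $d$-th powers of linear forms; in geometric terms it corresponds to a finite set $A\subset\mathbb{P}^n$ with $[f]\in\langle\nu_d(A)\rangle$. Each $p\in\mathbb{P}^n$ gives a linear condition on $\mathbb{C}[z_0,\dots,z_n]_t$ by evaluating forms at a representative of $p$ in $\mathbb{C}^{n+1}\setminus\{0\}$. A finite set $S$ gives $|S|$ independent conditions to $\mathbb{C}[z_0,\dots,z_n]_t$ if the corresponding $|S|$ evaluation functionals are linearly independent. *)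

theory Defs
  imports Complex_Main "HOL-Library.Poly_Mapping"
begin

text \<open>
  Complex polynomials in the variables z_i (i a natural number), as finitely supported maps from
  exponent vectors to coefficients; ring operations and powers are the convolution ones of
  \<^theory>\<open>HOL-Library.Poly_Mapping\<close>.
\<close>

type_synonym cpoly = "(nat \<Rightarrow>\<^sub>0 nat) \<Rightarrow>\<^sub>0 complex"

definition scale :: "complex \<Rightarrow> cpoly \<Rightarrow> cpoly" where
  "scale c f = Poly_Mapping.single 0 c * f"

interpretation cpoly: vector_space scale
  by unfold_locales
    (simp_all add: scale_def distrib_left distrib_right mult_single single_add
      mult.assoc[symmetric])

definition monomials :: "nat \<Rightarrow> nat \<Rightarrow> (nat \<Rightarrow>\<^sub>0 nat) set" where
  "monomials n t = {m. Poly_Mapping.keys m \<subseteq> {..n} \<and> (\<Sum>i\<le>n. Poly_Mapping.lookup m i) = t}"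

text \<open>The space of forms of degree t in the n + 1 variables z_0, ..., z_n; it contains 0.\<close>

definition forms :: "nat \<Rightarrow> nat \<Rightarrow> cpoly set" where
  "forms n t = {f. Poly_Mapping.keys f \<subseteq> monomials n t}"

definition poly_eval :: "cpoly \<Rightarrow> (nat \<Rightarrow> complex) \<Rightarrow> complex" where
  "poly_eval f a =
     (\<Sum>m\<in>Poly_Mapping.keys f. Poly_Mapping.lookup f m *
        (\<Prod>i\<in>Poly_Mapping.keys m. a i ^ Poly_Mapping.lookup m i))"

definition proportional :: "(cpoly \<times> cpoly) set" where
  "proportional = {(f, g). \<exists>c. c \<noteq> 0 \<and> g = scale c f}"

definition proj_class :: "cpoly \<Rightarrow> cpoly set" where
  "proj_class f = proportional `` {f}"

definition projectivization :: "cpoly set \<Rightarrow> cpoly set set" where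
  "projectivization V = (V - {0}) // proportional"

text \<open>Points of projective n-space are classes of linear forms, not of coordinate vectors.\<close>

definition proj_space :: "nat \<Rightarrow> cpoly set set" where
  "proj_space n = projectivization (forms n 1)"

definition veronese :: "nat \<Rightarrow> cpoly set \<Rightarrow> cpoly set" where
  "veronese d p = (\<Union>l\<in>p. proj_class (l ^ d))"

text \<open>
  Each point of X is itself a set of polynomials, so the union of X is the set of all
  representatives of points of X. The projective span of the empty set is empty.
\<close>

definition proj_span :: "cpoly set set \<Rightarrow> cpoly set set" where
  "proj_span X = projectivization (cpoly.span (\<Union>X))"

definition minimally_spans :: "nat \<Rightarrow> cpoly set set \<Rightarrow> cpoly set \<Rightarrow> bool" where
  "minimally_spans d S q \<longleftrightarrow>
     q \<in> proj_span (veronese d ` S) \<and>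
     (\<forall>S'. S' \<subset> S \<longrightarrow> q \<notin> proj_span (veronese d ` S'))"

definition coords :: "cpoly \<Rightarrow> nat \<Rightarrow> complex" where
  "coords l i = Poly_Mapping.lookup l (Poly_Mapping.single i 1)"

text \<open>
  The evaluation functional at a point depends on the representative chosen, but for forms only up
  to a non-zero factor (\<open>eval_at_proj_class\<close> below), so neither vanishing nor linear independence
  is affected by the choice.
\<close>

definition eval_at :: "cpoly set \<Rightarrow> cpoly \<Rightarrow> complex" where
  "eval_at p g = poly_eval g (coords (SOME l. l \<in> p))"

text \<open>
  Linear independence of the family of functionals on \<open>forms n t\<close> indexed by the (finite) set S;
  two points of S giving the same functional would count as a dependency.
\<close>

definition independent_conditions :: "nat \<Rightarrow> nat \<Rightarrow> cpoly set set \<Rightarrow> bool" where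
  "independent_conditions n t S \<longleftrightarrow>
     (\<forall>c. (\<forall>g\<in>forms n t. (\<Sum>p\<in>S. c p * eval_at p g) = 0) \<longrightarrow> (\<forall>p\<in>S. c p = 0))"

definition vanishing_forms :: "nat \<Rightarrow> nat \<Rightarrow> cpoly set set \<Rightarrow> cpoly set" where
  "vanishing_forms n t X = {g \<in> forms n t. \<forall>p\<in>X. eval_at p g = 0}"


text \<open>Independence of the choices of representatives.\<close>

lemma lookup_scale: "Poly_Mapping.lookup (scale c f) m = c * Poly_Mapping.lookup f m"
  by (simp add: scale_def flip: mult_map_scale_conv_mult) (simp add: map.rep_eq when_def)

lemma keys_scale: "c \<noteq> 0 \<Longrightarrow> Poly_Mapping.keys (scale c f) = Poly_Mapping.keys f"
  by (auto simp: in_keys_iff lookup_scale)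

lemma equiv_proportional: "equiv UNIV proportional"
proof (rule equivI)
  show "refl proportional"
    by (auto simp: refl_on_def proportional_def intro!: exI[of _ 1])
  show "sym proportional"
  proof (rule symI)
    fix f g assume "(f, g) \<in> proportional"
    then obtain c where "c \<noteq> 0" "g = scale c f" by (auto simp: proportional_def)
    then show "(g, f) \<in> proportional"
      by (auto simp: proportional_def intro!: exI[of _ "inverse c"])
  qed
  show "trans proportional"
  proof (rule transI)
    fix f g h assume "(f, g) \<in> proportional" "(g, h) \<in> proportional"
    then obtain c c' where "c \<noteq> 0" "g = scale c f" "c' \<noteq> 0" "h = scale c' g"
      by (auto simp: proportional_def)
    then show "(f, h) \<in> proportional"
      by (auto simp: proportional_def intro!: exI[of _ "c' * c"])
  qed
qed auto

lemma proj_class_scale: "c \<noteq> 0 \<Longrightarrow> proj_class (scale c f) = proj_class f"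
  unfolding proj_class_def
  by (rule equiv_class_eq[OF equiv_proportional, symmetric]) (auto simp: proportional_def)

lemma scale_power: "scale c l ^ d = scale (c ^ d) (l ^ d)"
proof (induction d)
  case 0
  then show ?case by (simp add: scale_def)
next
  case (Suc d)
  have "scale a x * scale b y = scale (a * b) (x * y)" for a b x y
  proof -
    have "scale a x * scale b y =
        (Poly_Mapping.single 0 a * Poly_Mapping.single 0 b) * (x * y)"
      by (simp only: scale_def ac_simps)
    then show ?thesis by (simp add: scale_def mult_single)
  qed
  with Suc show ?case by simp
qed

lemma veronese_proj_class: "veronese d (proj_class l) = proj_class (l ^ d)"
proof -
  have "proj_class (k ^ d) = proj_class (l ^ d)" if "k \<in> proj_class l" for k
    using that by (auto simp: proj_class_def[of l] proportional_def scale_power proj_class_scale)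
  moreover have "l \<in> proj_class l"
    using equiv_class_self[OF equiv_proportional] by (auto simp: proj_class_def)
  ultimately show ?thesis unfolding veronese_def by blast
qed

lemma poly_eval_homogeneous:
  assumes "g \<in> forms n t"
  shows "poly_eval g (\<lambda>i. c * a i) = c ^ t * poly_eval g a"
  unfolding poly_eval_def sum_distrib_left
proof (rule sum.cong)
  fix m assume "m \<in> Poly_Mapping.keys g"
  then have m: "m \<in> monomials n t" using assms by (auto simp: forms_def)
  have "(\<Sum>i\<in>Poly_Mapping.keys m. Poly_Mapping.lookup m i) = (\<Sum>i\<le>n. Poly_Mapping.lookup m i)"
    using m by (intro sum.mono_neutral_left) (auto simp: monomials_def in_keys_iff)
  then have "(\<Prod>i\<in>Poly_Mapping.keys m. c ^ Poly_Mapping.lookup m i) = c ^ t"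
    using m by (simp add: monomials_def flip: power_sum)
  then show "Poly_Mapping.lookup g m *
      (\<Prod>i\<in>Poly_Mapping.keys m. (c * a i) ^ Poly_Mapping.lookup m i) =
    c ^ t * (Poly_Mapping.lookup g m *
      (\<Prod>i\<in>Poly_Mapping.keys m. a i ^ Poly_Mapping.lookup m i))"
    by (simp add: power_mult_distrib prod.distrib)
qed simp

lemma eval_at_proj_class:
  "\<exists>c. c \<noteq> 0 \<and> (\<forall>n t. \<forall>g\<in>forms n t. eval_at (proj_class l) g = c ^ t * poly_eval g (coords l))"
proof -
  have "l \<in> proj_class l"
    using equiv_class_self[OF equiv_proportional] by (auto simp: proj_class_def)
  then have "(SOME k. k \<in> proj_class l) \<in> proj_class l" by (rule someI)
  then obtain c where c: "c \<noteq> 0" "(SOME k. k \<in> proj_class l) = scale c l"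
    by (auto simp: proj_class_def proportional_def)
  moreover have "coords (scale c l) = (\<lambda>i. c * coords l i)"
    by (simp add: coords_def lookup_scale fun_eq_iff)
  ultimately show ?thesis
    by (intro exI[of _ c]) (auto simp: eval_at_def poly_eval_homogeneous)
qed

end

theory Submission
  imports Defs "HOL-Library.Function_Algebras"
begin

text \<open>
  Write \<open>s = d div 2\<close> and \<open>t = d - s\<close>, so that \<open>s \<le> t\<close>. The idea is apolarity. On forms of
  degree \<open>d\<close>, evaluation at a point \<open>[l]\<close> can be read off from the polynomial \<open>l ^ d\<close>: the
  coefficient of a monomial in \<open>l ^ d\<close> is the value of that monomial at \<open>l\<close> times a positive
  multinomial coefficient that does not depend on \<open>l\<close>
  (\<open>lookup_power_linear_form\<close>). Hence a linear relation among \<open>d\<close>-th powers is a linear relation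
  among evaluations (\<open>power_sum_determines_evaluations\<close>). If \<open>f\<close> is the sum of \<open>b\<^sub>p l\<^sub>p ^ d\<close> over
  \<open>p \<in> S\<close> and also the sum of \<open>c\<^sub>a l\<^sub>a ^ d\<close> over \<open>a \<in> A\<close>, then
  \<open>\<Sum>p\<in>S. b\<^sub>p F(p) = \<Sum>a\<in>A. c\<^sub>a F(a)\<close> for every form \<open>F\<close> of degree \<open>d\<close>.

  Take \<open>F = g h\<close> with \<open>g\<close> of degree \<open>s\<close> vanishing on \<open>A\<close> and \<open>h\<close> any form of degree \<open>t\<close>. The right
  hand side is zero, so \<open>\<Sum>p\<in>S. b\<^sub>p g(p) h(p) = 0\<close> for all \<open>h\<close>. Independence of the conditions
  imposed by \<open>S\<close> passes from degree \<open>s\<close> up to degree \<open>t\<close>, so \<open>b\<^sub>p g(p) = 0\<close>; minimality of \<open>S\<close>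
  makes every \<open>b\<^sub>p\<close> non-zero, whence \<open>g\<close> vanishes on \<open>S\<close>
  (\<open>vanishing_forms_subset_if_same_power_sum\<close>).

  Finally, the forms vanishing on \<open>S\<close> have codimension exactly \<open>|S|\<close> by independence, and those
  vanishing on \<open>A\<close> have codimension at most \<open>|A| = |S|\<close>, so the inclusion is an equality. The count
  is made in the dual space (\<open>common_kernel_eq_if_independent\<close>).
\<close>


section \<open>Linear functionals and their common kernels\<close>

context vector_space
begin

text \<open>
  Induction on \<open>A\<close>: the induction hypothesis, applied to the kernel of one functional \<open>\<psi> b\<close>, leaves a
  remainder that vanishes wherever \<open>\<psi> b\<close> does, and such a functional is a multiple of \<open>\<psi> b\<close>.
\<close>

lemma functional_in_span_of_kernel_le:
  fixes \<psi> :: "'i \<Rightarrow> 'b \<Rightarrow> 'a"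
  assumes "finite A"
    and "\<And>a. a \<in> A \<Longrightarrow> Vector_Spaces.linear scale (*) (\<psi> a)"
    and "subspace V" and "Vector_Spaces.linear scale (*) \<phi>"
    and "\<And>x. x \<in> V \<Longrightarrow> (\<forall>a\<in>A. \<psi> a x = 0) \<Longrightarrow> \<phi> x = 0"
  shows "\<exists>c. \<forall>x\<in>V. \<phi> x = (\<Sum>a\<in>A. c a * \<psi> a x)"
  using assms
proof (induction A arbitrary: V rule: finite_induct)
  case empty
  then show ?case by simp
next
  case (insert b A)
  interpret \<phi>: Vector_Spaces.linear scale "(*)" \<phi> by fact
  interpret \<psi>b: Vector_Spaces.linear scale "(*)" "\<psi> b" using insert.prems(1) by simp
  have \<psi>: "Vector_Spaces.linear scale (*) (\<psi> a)" if "a \<in> A" for a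
    using insert.prems(1) that by simp
  have "subspace {x \<in> V. \<psi> b x = 0}"
    using insert.prems(2) by (auto simp: subspace_def \<psi>b.add \<psi>b.scale)
  from insert.IH[OF \<psi> this insert.prems(3)] insert.prems(4)
  obtain c where c: "\<And>x. x \<in> V \<Longrightarrow> \<psi> b x = 0 \<Longrightarrow> \<phi> x = (\<Sum>a\<in>A. c a * \<psi> a x)"
    by auto
  \<comment> \<open>The remainder; it vanishes on the kernel of \<open>\<psi> b\<close> in \<open>V\<close>.\<close>
  define \<rho> where "\<rho> x = \<phi> x - (\<Sum>a\<in>A. c a * \<psi> a x)" for x
  show ?case
  proof (cases "\<exists>y\<in>V. \<psi> b y \<noteq> 0")
    case True
    then obtain y where y: "y \<in> V" "\<psi> b y \<noteq> 0" by blast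
    have "\<rho> x = \<rho> y / \<psi> b y * \<psi> b x" if "x \<in> V" for x
    proof -
      \<comment> \<open>\<open>x - k y\<close> is the projection of \<open>x\<close> to the kernel of \<open>\<psi> b\<close> along \<open>y\<close>.\<close>
      define k where "k = \<psi> b x / \<psi> b y"
      have "x - scale k y \<in> V"
        using insert.prems(2) that y(1) by (intro subspace_diff subspace_scale) auto
      moreover have "\<psi> b (x - scale k y) = 0"
        using y(2) by (simp add: \<psi>b.diff \<psi>b.scale k_def)
      ultimately have "\<rho> (x - scale k y) = 0"
        using c by (simp add: \<rho>_def)
      moreover have "\<rho> (x - scale k y) = \<rho> x - k * \<rho> y"
      proof -
        have "\<psi> a (x - scale k y) = \<psi> a x - k * \<psi> a y" if "a \<in> A" for a
        proof -
          interpret \<psi>a: Vector_Spaces.linear scale "(*)" "\<psi> a" by (rule \<psi>[OF that])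
          show ?thesis by (simp add: \<psi>a.diff \<psi>a.scale)
        qed
        then have "(\<Sum>a\<in>A. c a * \<psi> a (x - scale k y)) =
            (\<Sum>a\<in>A. c a * \<psi> a x - k * (c a * \<psi> a y))"
          by (intro sum.cong) (simp_all add: right_diff_distrib)
        also have "\<dots> = (\<Sum>a\<in>A. c a * \<psi> a x) - k * (\<Sum>a\<in>A. c a * \<psi> a y)"
          by (simp only: sum_subtractf sum_distrib_left)
        finally show ?thesis
          unfolding \<rho>_def \<phi>.diff \<phi>.scale by (simp only: right_diff_distrib) simp
      qed
      ultimately show ?thesis by (simp add: k_def)
    qed
    then have "\<phi> x = (\<Sum>a\<in>insert b A. (c(b := \<rho> y / \<psi> b y)) a * \<psi> a x)" if "x \<in> V" for x
    proof -
      have "(\<Sum>a\<in>A. (c(b := \<rho> y / \<psi> b y)) a * \<psi> a x) = (\<Sum>a\<in>A. c a * \<psi> a x)"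
        using insert.hyps(2) by (intro sum.cong) auto
      moreover have "\<phi> x = \<rho> x + (\<Sum>a\<in>A. c a * \<psi> a x)" by (simp add: \<rho>_def)
      ultimately show ?thesis
        using \<open>\<And>x. x \<in> V \<Longrightarrow> \<rho> x = _\<close>[OF that] insert.hyps by simp
    qed
    then show ?thesis by blast
  next
    case False
    then have "\<phi> x = (\<Sum>a\<in>insert b A. c a * \<psi> a x)" if "x \<in> V" for x
      using c that insert.hyps by simp
    then show ?thesis by blast
  qed
qed

text \<open>
  A dimension count without dimensions of \<open>V\<close>, which may be infinite: by the inclusion of kernels,
  the independent functionals \<open>\<phi> p\<close> lie in the span of the \<open>\<psi> a\<close>. Were some \<open>\<psi> b\<close> outside the span of
  the \<open>\<phi> p\<close>, it could be added to them, giving more independent vectors than the spanning set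
  \<open>\<psi> ` A\<close> allows. So every \<open>\<psi> b\<close> vanishes where all \<open>\<phi> p\<close> do.
\<close>

lemma common_kernel_eq_if_independent:
  fixes \<phi> :: "'i \<Rightarrow> 'b \<Rightarrow> 'a" and \<psi> :: "'j \<Rightarrow> 'b \<Rightarrow> 'a"
  assumes "finite S" and "finite A" and "card A \<le> card S" and "subspace V"
    and \<phi>: "\<And>p. p \<in> S \<Longrightarrow> Vector_Spaces.linear scale (*) (\<phi> p)"
    and \<psi>: "\<And>a. a \<in> A \<Longrightarrow> Vector_Spaces.linear scale (*) (\<psi> a)"
    and indep: "\<And>c. (\<forall>x\<in>V. (\<Sum>p\<in>S. c p * \<phi> p x) = 0) \<Longrightarrow> \<forall>p\<in>S. c p = 0"
    and le: "{x \<in> V. \<forall>a\<in>A. \<psi> a x = 0} \<subseteq> {x \<in> V. \<forall>p\<in>S. \<phi> p x = 0}"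
  shows "{x \<in> V. \<forall>a\<in>A. \<psi> a x = 0} = {x \<in> V. \<forall>p\<in>S. \<phi> p x = 0}"
proof (rule ccontr)
  assume "\<not> ?thesis"
  with le obtain y b where y: "y \<in> V" "\<forall>p\<in>S. \<phi> p y = 0" and b: "b \<in> A" "\<psi> b y \<noteq> 0"
    by blast
  interpret dual: vector_space "\<lambda>c (\<chi>::'b \<Rightarrow> 'a) x. c * \<chi> x"
    by unfold_locales (auto simp: fun_eq_iff algebra_simps)
  \<comment> \<open>The hypotheses only concern values on \<open>V\<close>, so functionals are restricted to \<open>V\<close> and extended
    by zero; two functionals that agree on \<open>V\<close> then become equal as functions.\<close>
  define on_V where "on_V \<chi> x = (if x \<in> V then \<chi> x else 0)" for \<chi> :: "'b \<Rightarrow> 'a" and x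
  define \<Phi> where "\<Phi> = (\<lambda>p. on_V (\<phi> p)) ` S"
  define \<Psi> where "\<Psi> = (\<lambda>a. on_V (\<psi> a)) ` A"
  have sum_apply: "(\<Sum>i\<in>I. h i) x = (\<Sum>i\<in>I. h i x)" for I and h :: "'k \<Rightarrow> 'b \<Rightarrow> 'a" and x
    by (induction I rule: infinite_finite_induct) auto
  have inj: "inj_on (\<lambda>p. on_V (\<phi> p)) S"
  proof (rule inj_onI, rule ccontr)
    fix p p' assume p: "p \<in> S" "p' \<in> S" "on_V (\<phi> p) = on_V (\<phi> p')" "p \<noteq> p'"
    \<comment> \<open>Two equal members of the family would be a dependency with coefficients 1 and -1.\<close>
    define c where "c r = (if r = p then 1 else if r = p' then - 1 else 0::'a)" for r
    have "(\<Sum>r\<in>S. c r * \<phi> r x) = 0" if "x \<in> V" for x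
    proof -
      have "(\<Sum>r\<in>S. c r * \<phi> r x) = (\<Sum>r\<in>{p, p'}. c r * \<phi> r x)"
        using p \<open>finite S\<close> by (intro sum.mono_neutral_right) (auto simp: c_def)
      also have "\<dots> = \<phi> p x - \<phi> p' x" using p(4) by (simp add: c_def)
      also have "\<dots> = 0" using fun_cong[OF p(3), of x] that by (simp add: on_V_def)
      finally show ?thesis .
    qed
    then have "\<forall>r\<in>S. c r = 0" by (intro indep) blast
    then show False using p(1) by (force simp: c_def)
  qed
  have "dual.independent \<Phi>"
  proof (rule dual.independent_if_scalars_zero)
    show "finite \<Phi>" using \<open>finite S\<close> by (simp add: \<Phi>_def)
  next
    fix c \<chi> assume sum0: "(\<Sum>\<chi>\<in>\<Phi>. (\<lambda>x. c \<chi> * \<chi> x)) = 0" and "\<chi> \<in> \<Phi>"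
    have "(\<Sum>p\<in>S. c (on_V (\<phi> p)) * \<phi> p x) = 0" if "x \<in> V" for x
    proof -
      have "(\<Sum>p\<in>S. c (on_V (\<phi> p)) * \<phi> p x) = (\<Sum>p\<in>S. c (on_V (\<phi> p)) * on_V (\<phi> p) x)"
        using that by (simp add: on_V_def)
      also have "\<dots> = (\<Sum>\<chi>\<in>\<Phi>. c \<chi> * \<chi> x)"
        by (simp add: \<Phi>_def sum.reindex[OF inj])
      also have "\<dots> = 0" using fun_cong[OF sum0, of x] by (simp add: sum_apply)
      finally show ?thesis .
    qed
    then have "\<forall>p\<in>S. c (on_V (\<phi> p)) = 0" by (intro indep) blast
    then show "c \<chi> = 0" using \<open>\<chi> \<in> \<Phi>\<close> by (auto simp: \<Phi>_def)
  qed
  moreover have "\<chi> y = 0" if "\<chi> \<in> dual.span \<Phi>" for \<chi>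
    using that by (induction rule: dual.span_induct_alt) (use y in \<open>auto simp: \<Phi>_def on_V_def\<close>)
  then have not_in: "on_V (\<psi> b) \<notin> dual.span \<Phi>"
    using b y(1) by (force simp: on_V_def)
  ultimately have "dual.independent (insert (on_V (\<psi> b)) \<Phi>)"
    by (simp add: dual.independent_insert)
  moreover have "on_V (\<phi> p) \<in> dual.span \<Psi>" if p: "p \<in> S" for p
  proof -
    have "\<exists>c. \<forall>x\<in>V. \<phi> p x = (\<Sum>a\<in>A. c a * \<psi> a x)"
      using le p by (intro functional_in_span_of_kernel_le \<open>finite A\<close> \<psi> \<open>subspace V\<close> \<phi>) auto
    then obtain c where c: "\<And>x. x \<in> V \<Longrightarrow> \<phi> p x = (\<Sum>a\<in>A. c a * \<psi> a x)"
      by blast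
    have "on_V (\<phi> p) = (\<Sum>a\<in>A. (\<lambda>x. c a * on_V (\<psi> a) x))"
      by (auto simp: fun_eq_iff sum_apply on_V_def c)
    also have "\<dots> \<in> dual.span \<Psi>"
      by (intro dual.span_sum dual.span_scale dual.span_base) (auto simp: \<Psi>_def)
    finally show ?thesis .
  qed
  then have "insert (on_V (\<psi> b)) \<Phi> \<subseteq> dual.span \<Psi>"
    using b(1) by (auto simp: \<Phi>_def \<Psi>_def intro: dual.span_base)
  ultimately have "card (insert (on_V (\<psi> b)) \<Phi>) \<le> card \<Psi>"
    using dual.independent_span_bound[of \<Psi>] \<open>finite A\<close> by (simp add: \<Psi>_def)
  moreover have "on_V (\<psi> b) \<notin> \<Phi>" using not_in dual.span_base by blast
  then have "card (insert (on_V (\<psi> b)) \<Phi>) = Suc (card S)"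
    using \<open>finite S\<close> card_image[OF inj] by (simp add: \<Phi>_def)
  moreover have "card \<Psi> \<le> card A" using \<open>finite A\<close> by (simp add: \<Psi>_def card_image_le)
  ultimately show False using \<open>card A \<le> card S\<close> by simp
qed

end


section \<open>Evaluation of polynomials\<close>

definition monomial_at :: "(nat \<Rightarrow> complex) \<Rightarrow> (nat \<Rightarrow>\<^sub>0 nat) \<Rightarrow> complex" where
  "monomial_at a m = (\<Prod>i\<in>Poly_Mapping.keys m. a i ^ Poly_Mapping.lookup m i)"

lemma monomial_at_superset:
  "finite I \<Longrightarrow> Poly_Mapping.keys m \<subseteq> I \<Longrightarrow>
    monomial_at a m = (\<Prod>i\<in>I. a i ^ Poly_Mapping.lookup m i)"
  unfolding monomial_at_def by (intro prod.mono_neutral_left) (auto simp: in_keys_iff)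

lemma monomial_at_add: "monomial_at a (m + m') = monomial_at a m * monomial_at a m'"
proof -
  let ?I = "Poly_Mapping.keys m \<union> Poly_Mapping.keys m'"
  show ?thesis
    using monomial_at_superset[of ?I m a] monomial_at_superset[of ?I m' a]
      monomial_at_superset[of ?I "m + m'" a] keys_add[of m m']
    by (simp add: lookup_add power_add prod.distrib)
qed

lemma monomial_at_variable: "monomial_at a (Poly_Mapping.single i 1) = a i"
  by (simp add: monomial_at_def)

lemma poly_eval_superset:
  assumes "finite M" and "Poly_Mapping.keys f \<subseteq> M"
  shows "poly_eval f a = (\<Sum>m\<in>M. Poly_Mapping.lookup f m * monomial_at a m)"
  unfolding poly_eval_def monomial_at_def
  using assms by (intro sum.mono_neutral_left) (auto simp: in_keys_iff)

lemma poly_eval_add: "poly_eval (f + g) a = poly_eval f a + poly_eval g a"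
proof -
  let ?M = "Poly_Mapping.keys f \<union> Poly_Mapping.keys g"
  show ?thesis
    using poly_eval_superset[of ?M f a] poly_eval_superset[of ?M g a]
      poly_eval_superset[of ?M "f + g" a] keys_add[of f g]
    by (simp add: lookup_add algebra_simps sum.distrib)
qed

lemma poly_eval_scale: "poly_eval (scale c f) a = c * poly_eval f a"
  using poly_eval_superset[of "Poly_Mapping.keys f" "scale c f" a]
    poly_eval_superset[of "Poly_Mapping.keys f" f a]
  by (simp add: subset_iff in_keys_iff lookup_scale sum_distrib_left mult.assoc)

lemma linear_poly_eval: "Vector_Spaces.linear scale (*) (\<lambda>f. poly_eval f a)"
  by unfold_locales (simp_all add: poly_eval_add poly_eval_scale algebra_simps)

lemma poly_eval_single: "poly_eval (Poly_Mapping.single m c) a = c * monomial_at a m"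
  using poly_eval_superset[of "{m}" "Poly_Mapping.single m c" a] by simp

lemma poly_eval_sum: "poly_eval (\<Sum>i\<in>I. h i) a = (\<Sum>i\<in>I. poly_eval (h i) a)"
  by (rule module_hom.sum[OF module_hom_linearI[OF linear_poly_eval]])

lemma sum_of_terms: "(\<Sum>m\<in>Poly_Mapping.keys f. Poly_Mapping.single m (Poly_Mapping.lookup f m)) = f"
  by (rule poly_mapping_eqI) (auto simp: lookup_sum lookup_single when_def in_keys_iff sum.delta)

lemma poly_eval_mult: "poly_eval (f * g) a = poly_eval f a * poly_eval g a"
proof -
  have "f * g = (\<Sum>m\<in>Poly_Mapping.keys f. \<Sum>m'\<in>Poly_Mapping.keys g.
      Poly_Mapping.single (m + m') (Poly_Mapping.lookup f m * Poly_Mapping.lookup g m'))"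
    by (subst (1 2) sum_of_terms[symmetric]) (simp add: sum_product mult_single)
  then have "poly_eval (f * g) a = (\<Sum>m\<in>Poly_Mapping.keys f. \<Sum>m'\<in>Poly_Mapping.keys g.
      Poly_Mapping.lookup f m * Poly_Mapping.lookup g m' * (monomial_at a m * monomial_at a m'))"
    by (simp add: poly_eval_sum poly_eval_single monomial_at_add)
  also have "\<dots> = poly_eval f a * poly_eval g a"
    by (simp add: poly_eval_superset[OF finite_keys subset_refl] sum_product algebra_simps)
  finally show ?thesis .
qed


section \<open>Forms\<close>

lemma subspace_forms: "cpoly.subspace (forms n t)"
proof (rule cpoly.subspaceI)
  fix g h assume "g \<in> forms n t" "h \<in> forms n t"
  then show "g + h \<in> forms n t" using keys_add[of g h] by (auto simp: forms_def)
next
  fix c g assume "g \<in> forms n t"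
  then show "scale c g \<in> forms n t"
    by (cases "c = 0") (simp_all add: forms_def keys_scale)
qed (simp add: forms_def)

lemma mult_in_forms:
  assumes "g \<in> forms n s" and "h \<in> forms n t"
  shows "g * h \<in> forms n (s + t)"
proof -
  have "m + m' \<in> monomials n (s + t)" if "m \<in> monomials n s" "m' \<in> monomials n t" for m m'
  proof -
    have "Poly_Mapping.keys (m + m') \<subseteq> {..n}"
      using that keys_add[of m m'] unfolding monomials_def by blast
    then show ?thesis using that by (simp add: monomials_def lookup_add sum.distrib)
  qed
  moreover have "m \<in> {m + m' |m m'. m \<in> Poly_Mapping.keys g \<and> m' \<in> Poly_Mapping.keys h}"
    if "m \<in> Poly_Mapping.keys (g * h)" for m
    using that keys_mult by (rule subsetD[rotated])
  ultimately show ?thesis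
    using assms unfolding forms_def by blast
qed

lemma variable_in_forms:
  "i \<le> n \<Longrightarrow> Poly_Mapping.single (Poly_Mapping.single i 1) 1 \<in> forms n 1"
  by (auto simp: forms_def monomials_def lookup_single when_def sum.delta)

lemma monomials_1_cases:
  assumes "m \<in> monomials n 1"
  obtains i where "i \<le> n" "m = Poly_Mapping.single i 1"
proof -
  have m: "Poly_Mapping.keys m \<subseteq> {..n}" "(\<Sum>i\<le>n. Poly_Mapping.lookup m i) = 1"
    using assms by (auto simp: monomials_def)
  then obtain i where i: "i \<le> n" "Poly_Mapping.lookup m i = 1"
      "\<forall>j\<le>n. j \<noteq> i \<longrightarrow> Poly_Mapping.lookup m j = 0"
    using sum_eq_1_iff[of "{..n}" "Poly_Mapping.lookup m"] by auto
  have "Poly_Mapping.lookup m j = 0" if "j \<noteq> i" for j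
    using i(3) that m(1) by (cases "j \<le> n") (auto simp: in_keys_iff subset_iff)
  then have "m = Poly_Mapping.single i 1"
    using i(2) by (intro poly_mapping_eqI) (auto simp: lookup_single when_def)
  with i(1) that show thesis by blast
qed

lemma linear_form_eq_sum_coords:
  assumes "l \<in> forms n 1"
  shows "l = (\<Sum>i\<le>n. Poly_Mapping.single (Poly_Mapping.single i 1) (coords l i))"
proof (rule poly_mapping_eqI)
  fix m
  show "Poly_Mapping.lookup l m = Poly_Mapping.lookup
      (\<Sum>i\<le>n. Poly_Mapping.single (Poly_Mapping.single i 1) (coords l i)) m"
  proof (cases "m \<in> Poly_Mapping.keys l")
    case True
    then have "m \<in> monomials n 1" using assms by (auto simp: forms_def)
    then obtain j where j: "j \<le> n" "m = Poly_Mapping.single j 1"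
      by (rule monomials_1_cases)
    have "Poly_Mapping.single i (1::nat) = Poly_Mapping.single j 1 \<longleftrightarrow> i = j" for i
      by (metis lookup_single_eq lookup_single_not_eq zero_neq_one)
    then show ?thesis
      using j by (simp add: lookup_sum lookup_single when_def sum.delta coords_def)
  next
    case False
    then have "(coords l i when Poly_Mapping.single i 1 = m) = 0" for i
      by (auto simp: coords_def in_keys_iff when_def)
    then show ?thesis
      using False by (simp add: lookup_sum lookup_single in_keys_iff)
  qed
qed

lemma linear_form_nonzero_coord:
  assumes "l \<in> forms n 1" and "l \<noteq> 0"
  obtains i where "i \<le> n" "coords l i \<noteq> 0"
proof -
  have "\<not> (\<forall>i\<le>n. coords l i = 0)"
    using linear_form_eq_sum_coords[OF assms(1)] assms(2) by (metis (no_types, lifting) atMost_iff single_zero sum.neutral)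
  with that show thesis by blast
qed


section \<open>Powers of linear forms represent evaluation functionals\<close>

lemma variable_plus_minus:
  "i \<in> Poly_Mapping.keys m \<Longrightarrow> Poly_Mapping.single i (1::nat) + (m - Poly_Mapping.single i 1) = m"
  by (rule poly_mapping_eqI)
    (auto simp: lookup_add lookup_minus lookup_single when_def in_keys_iff)

lemma lookup_variable_mult:
  fixes h :: cpoly
  shows "Poly_Mapping.lookup (Poly_Mapping.single (Poly_Mapping.single i 1) c * h) m =
    (if i \<in> Poly_Mapping.keys m
     then c * Poly_Mapping.lookup h (m - Poly_Mapping.single i 1) else 0)"
proof -
  have "Poly_Mapping.lookup (Poly_Mapping.single (Poly_Mapping.single i 1) c * h) m =
      c * (\<Sum>q. Poly_Mapping.lookup h q when m = Poly_Mapping.single i 1 + q)"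
    by (simp add: lookup_mult lookup_single when_mult)
  moreover have "m = Poly_Mapping.single i 1 + q \<longleftrightarrow>
      i \<in> Poly_Mapping.keys m \<and> q = m - Poly_Mapping.single i 1" for q
    using variable_plus_minus[of i m] by (auto simp: in_keys_iff lookup_add)
  ultimately show ?thesis by simp
qed

text \<open>
  The number \<open>K m\<close> is the multinomial coefficient of \<open>m\<close>. Only its positivity and its independence of
  \<open>l\<close> matter, so it is produced by the recursion that multiplication by one more factor \<open>l\<close> gives,
  a generalised Pascal rule: \<open>K m\<close> is the sum of the \<open>K (m - e\<^sub>i)\<close> over the variables occurring
  in \<open>m\<close>.
\<close>

lemma lookup_power_linear_form:
  "\<exists>K. (\<forall>m\<in>monomials n d. K m > 0) \<and>
    (\<forall>l\<in>forms n 1. \<forall>m\<in>monomials n d.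
      Poly_Mapping.lookup (l ^ d) m = of_nat (K m) * monomial_at (coords l) m)"
proof (induction d)
  case 0
  have "m = 0" if "m \<in> monomials n 0" for m
    using that by (intro poly_mapping_eqI) (auto simp: monomials_def in_keys_iff subset_iff)
  then show ?case
    by (intro exI[of _ "\<lambda>_. 1"]) (force simp: monomial_at_def)
next
  case (Suc d)
  then obtain K :: "(nat \<Rightarrow>\<^sub>0 nat) \<Rightarrow> nat" where
    K: "\<And>m. m \<in> monomials n d \<Longrightarrow> K m > 0"
    and lookup_power: "\<And>l m. l \<in> forms n 1 \<Longrightarrow> m \<in> monomials n d \<Longrightarrow>
      Poly_Mapping.lookup (l ^ d) m = of_nat (K m) * monomial_at (coords l) m"
    by blast
  let ?minus = "\<lambda>m i. m - Poly_Mapping.single i (1::nat)"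
  define K' where "K' m = (\<Sum>i\<in>Poly_Mapping.keys m. K (?minus m i))" for m
  have minus: "?minus m i \<in> monomials n d"
    if "m \<in> monomials n (Suc d)" "i \<in> Poly_Mapping.keys m" for m i
  proof -
    have "(\<Sum>j\<le>n. Poly_Mapping.lookup (Poly_Mapping.single i 1 + ?minus m i) j) = Suc d"
      using that(1) by (simp only: variable_plus_minus[OF that(2)]) (simp add: monomials_def)
    moreover have "(\<Sum>j\<le>n. Poly_Mapping.lookup (Poly_Mapping.single i (1::nat)) j) = 1"
      using that by (auto simp: monomials_def lookup_single when_def sum.delta)
    ultimately have "(\<Sum>j\<le>n. Poly_Mapping.lookup (?minus m i) j) = d"
      by (simp add: lookup_add sum.distrib)
    moreover have "Poly_Mapping.keys (?minus m i) \<subseteq> Poly_Mapping.keys m"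
      by (auto simp: in_keys_iff lookup_minus)
    ultimately show ?thesis using that(1) by (auto simp: monomials_def)
  qed
  have "K' m > 0" if "m \<in> monomials n (Suc d)" for m
  proof -
    have "Poly_Mapping.keys m \<noteq> {}" using that by (auto simp: monomials_def)
    then show ?thesis
      unfolding K'_def using K minus that by (intro sum_pos) auto
  qed
  moreover have "Poly_Mapping.lookup (l ^ Suc d) m = of_nat (K' m) * monomial_at (coords l) m"
    if l: "l \<in> forms n 1" and m: "m \<in> monomials n (Suc d)" for l m
  proof -
    have "l ^ Suc d =
        (\<Sum>i\<le>n. Poly_Mapping.single (Poly_Mapping.single i 1) (coords l i) * l ^ d)"
      using arg_cong[OF linear_form_eq_sum_coords[OF l], of "\<lambda>k. k * l ^ d"]
      by (simp only: power_Suc sum_distrib_right)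
    then have "Poly_Mapping.lookup (l ^ Suc d) m =
        (\<Sum>i\<le>n. if i \<in> Poly_Mapping.keys m
          then coords l i * Poly_Mapping.lookup (l ^ d) (?minus m i) else 0)"
      by (simp only: lookup_sum lookup_variable_mult)
    also have "\<dots> = (\<Sum>i\<in>Poly_Mapping.keys m.
        coords l i * Poly_Mapping.lookup (l ^ d) (?minus m i))"
      using m by (intro sum.mono_neutral_cong_right) (auto simp: monomials_def)
    also have "\<dots> = (\<Sum>i\<in>Poly_Mapping.keys m. of_nat (K (?minus m i)) * monomial_at (coords l) m)"
    proof (rule sum.cong)
      fix i assume i: "i \<in> Poly_Mapping.keys m"
      have "monomial_at (coords l) m = coords l i * monomial_at (coords l) (?minus m i)"
        using monomial_at_add[of "coords l" "Poly_Mapping.single i 1" "?minus m i"]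
        by (simp only: variable_plus_minus[OF i] monomial_at_variable)
      then show "coords l i * Poly_Mapping.lookup (l ^ d) (?minus m i) =
          of_nat (K (?minus m i)) * monomial_at (coords l) m"
        using lookup_power[OF l minus[OF m i]] by simp
    qed simp
    also have "\<dots> = of_nat (K' m) * monomial_at (coords l) m"
      by (simp add: K'_def sum_distrib_right)
    finally show ?thesis .
  qed
  ultimately show ?case by blast
qed

text \<open>
  The sum of \<open>b\<^sub>p F(u\<^sub>p)\<close> depends on the points and weights only through the polynomial
  \<open>\<Sum>p\<in>S. b\<^sub>p u\<^sub>p ^ d\<close>: it is the pairing of \<open>F\<close> with that polynomial in which the coefficients at \<open>m\<close>
  are multiplied and divided by the multinomial coefficient (the apolar pairing).
\<close>

lemma power_sum_determines_evaluations:
  fixes u v :: "'i \<Rightarrow> cpoly"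
  assumes u: "\<And>p. p \<in> S \<Longrightarrow> u p \<in> forms n 1" and v: "\<And>a. a \<in> A \<Longrightarrow> v a \<in> forms n 1"
    and eq: "(\<Sum>p\<in>S. scale (b p) (u p ^ d)) = (\<Sum>a\<in>A. scale (c a) (v a ^ d))"
    and F: "F \<in> forms n d"
  shows "(\<Sum>p\<in>S. b p * poly_eval F (coords (u p))) = (\<Sum>a\<in>A. c a * poly_eval F (coords (v a)))"
proof -
  obtain K :: "(nat \<Rightarrow>\<^sub>0 nat) \<Rightarrow> nat" where
    K: "\<And>m. m \<in> monomials n d \<Longrightarrow> K m > 0"
    and lookup_power: "\<And>l m. l \<in> forms n 1 \<Longrightarrow> m \<in> monomials n d \<Longrightarrow>
      Poly_Mapping.lookup (l ^ d) m = of_nat (K m) * monomial_at (coords l) m"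
    using lookup_power_linear_form[of n d] by blast
  let ?F = "\<lambda>m. Poly_Mapping.lookup F m / of_nat (K m)"
  have keys_F: "m \<in> monomials n d" if "m \<in> Poly_Mapping.keys F" for m
    using F that by (auto simp: forms_def)
  have "(\<Sum>p\<in>I. e p * poly_eval F (coords (w p))) =
      (\<Sum>m\<in>Poly_Mapping.keys F. ?F m * Poly_Mapping.lookup (\<Sum>p\<in>I. scale (e p) (w p ^ d)) m)"
    if w: "\<And>p. p \<in> I \<Longrightarrow> w p \<in> forms n 1" for I :: "'i set" and e and w :: "'i \<Rightarrow> cpoly"
  proof -
    have "poly_eval F (coords (w p)) =
        (\<Sum>m\<in>Poly_Mapping.keys F. ?F m * Poly_Mapping.lookup (w p ^ d) m)" if "p \<in> I" for p
    proof -
      have "Poly_Mapping.lookup F m * monomial_at (coords (w p)) m =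
          ?F m * Poly_Mapping.lookup (w p ^ d) m" if "m \<in> Poly_Mapping.keys F" for m
        using K[OF keys_F[OF that]] lookup_power[OF w[OF \<open>p \<in> I\<close>] keys_F[OF that]] by simp
      then show ?thesis
        unfolding poly_eval_superset[OF finite_keys subset_refl] by (intro sum.cong) simp_all
    qed
    then have "(\<Sum>p\<in>I. e p * poly_eval F (coords (w p))) =
        (\<Sum>p\<in>I. \<Sum>m\<in>Poly_Mapping.keys F. ?F m * Poly_Mapping.lookup (scale (e p) (w p ^ d)) m)"
      by (intro sum.cong) (auto simp: sum_distrib_left lookup_scale algebra_simps)
    also have "\<dots> = (\<Sum>m\<in>Poly_Mapping.keys F.
        \<Sum>p\<in>I. ?F m * Poly_Mapping.lookup (scale (e p) (w p ^ d)) m)"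
      by (rule sum.swap)
    finally show ?thesis by (simp add: lookup_sum sum_distrib_left)
  qed
  from this[OF u, of S] this[OF v, of A] show ?thesis by (simp add: eq)
qed


section \<open>Points of projective space and spans of their Veronese images\<close>

text \<open>The same representative as the one by which \<^const>\<open>eval_at\<close> evaluates.\<close>

definition representative :: "cpoly set \<Rightarrow> cpoly" where
  "representative p = (SOME l. l \<in> p)"

lemma eval_at_representative: "eval_at p g = poly_eval g (coords (representative p))"
  by (simp add: eval_at_def representative_def)

lemma self_in_proj_class: "f \<in> proj_class f"
  using equiv_class_self[OF equiv_proportional] by (auto simp: proj_class_def)

lemma representative_proj_space:
  assumes "p \<in> proj_space n"
  shows "representative p \<in> forms n 1" and "representative p \<noteq> 0"
    and "proj_class (representative p) = p"
proof -
  obtain l where l: "l \<in> forms n 1" "l \<noteq> 0" "p = proj_class l"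
    using assms by (auto simp: proj_space_def projectivization_def quotient_def proj_class_def)
  have "representative p \<in> p"
    unfolding representative_def l(3) using self_in_proj_class by (rule someI)
  then obtain c where c: "c \<noteq> 0" "representative p = scale c l"
    by (auto simp: l(3) proj_class_def proportional_def)
  show "representative p \<in> forms n 1"
    using l(1) c by (simp add: forms_def keys_scale)
  show "representative p \<noteq> 0" using l(2) c by simp
  show "proj_class (representative p) = p" using c l(3) by (simp add: proj_class_scale)
qed

lemma veronese_proj_space:
  "p \<in> proj_space n \<Longrightarrow> veronese d p = proj_class (representative p ^ d)"
  by (metis representative_proj_space(3) veronese_proj_class)

lemma proj_class_in_proj_span_iff:
  assumes "f \<noteq> 0"
  shows "proj_class f \<in> proj_span X \<longleftrightarrow> f \<in> cpoly.span (\<Union>X)"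
proof
  assume "proj_class f \<in> proj_span X"
  then obtain g where g: "g \<in> cpoly.span (\<Union>X)" "proj_class f = proj_class g"
    by (auto simp: proj_span_def projectivization_def quotient_def proj_class_def)
  then obtain c where "f = scale c g"
    using self_in_proj_class[of f] by (auto simp: proj_class_def proportional_def)
  with g show "f \<in> cpoly.span (\<Union>X)" by (simp add: cpoly.span_scale)
next
  assume "f \<in> cpoly.span (\<Union>X)"
  with assms show "proj_class f \<in> proj_span X"
    by (auto simp: proj_span_def projectivization_def quotient_def proj_class_def)
qed

lemma proj_class_in_span_veronese_iff:
  assumes "f \<noteq> 0" and "finite X" and "X \<subseteq> proj_space n"
  shows "proj_class f \<in> proj_span (veronese d ` X) \<longleftrightarrow>
    (\<exists>c. f = (\<Sum>p\<in>X. scale (c p) (representative p ^ d)))"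
proof -
  let ?B = "\<Union>(veronese d ` X)"
  have B: "?B = (\<Union>p\<in>X. proj_class (representative p ^ d))"
    using assms(3) veronese_proj_space[of _ n d] by (simp add: subset_iff)
  have "\<exists>c. g = (\<Sum>p\<in>X. scale (c p) (representative p ^ d))" if "g \<in> cpoly.span ?B" for g
    using that
  proof (induction rule: cpoly.span_induct_alt)
    case base
    show ?case by (intro exI[of _ "\<lambda>_. 0"]) simp
  next
    case (step k x y)
    from step obtain c where c: "y = (\<Sum>p\<in>X. scale (c p) (representative p ^ d))" by blast
    from step(1) obtain p k' where p: "p \<in> X" "x = scale k' (representative p ^ d)"
      unfolding B by (auto simp: proj_class_def proportional_def)
    have "scale k x = (\<Sum>r\<in>X. if r = p then scale (k * k') (representative p ^ d) else 0)"
      using p \<open>finite X\<close> by simp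
    also have "\<dots> = (\<Sum>r\<in>X. scale (if r = p then k * k' else 0) (representative r ^ d))"
      by (intro sum.cong) auto
    finally have "scale k x + y = (\<Sum>r\<in>X.
        scale ((if r = p then k * k' else 0) + c r) (representative r ^ d))"
      by (simp add: c cpoly.scale_left_distrib sum.distrib)
    then show ?case by (intro exI[of _ "\<lambda>r. (if r = p then k * k' else 0) + c r"])
  qed
  moreover have "(\<Sum>p\<in>X. scale (c p) (representative p ^ d)) \<in> cpoly.span ?B" for c
    unfolding B using self_in_proj_class
    by (intro cpoly.span_sum cpoly.span_scale cpoly.span_base) blast
  ultimately show ?thesis
    using proj_class_in_proj_span_iff[OF assms(1), of "veronese d ` X"] by blast
qed

text \<open>A point with coefficient zero could be dropped from \<open>S\<close>, against minimality.\<close>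

lemma minimally_spans_obtain_nonzero_coefficients:
  assumes "f \<noteq> 0" and "finite S" and "S \<subseteq> proj_space n"
    and "minimally_spans d S (proj_class f)"
  obtains c where "f = (\<Sum>p\<in>S. scale (c p) (representative p ^ d))" "\<forall>p\<in>S. c p \<noteq> 0"
proof -
  obtain c where c: "f = (\<Sum>p\<in>S. scale (c p) (representative p ^ d))"
    using assms(4) proj_class_in_span_veronese_iff[OF assms(1-3)]
    unfolding minimally_spans_def by blast
  have "c p \<noteq> 0" if "p \<in> S" for p
  proof
    assume "c p = 0"
    then have "f = (\<Sum>r\<in>S - {p}. scale (c r) (representative r ^ d))"
      using sum.remove[OF assms(2) that, of "\<lambda>r. scale (c r) (representative r ^ d)"]
      by (simp add: c)
    then have "proj_class f \<in> proj_span (veronese d ` (S - {p}))"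
      using assms(1-3) by (subst proj_class_in_span_veronese_iff[where n = n]) auto
    with assms(4) that show False by (auto simp: minimally_spans_def)
  qed
  with c that show thesis by blast
qed


section \<open>Independent conditions and apolarity\<close>

text \<open>
  Pick a coordinate \<open>z\<^sub>i\<close> that does not vanish at \<open>p\<close>. Testing a relation in degree \<open>t + 1\<close> on the
  products \<open>z\<^sub>i g\<close> gives a relation in degree \<open>t\<close> whose coefficients are multiplied by the values of
  \<open>z\<^sub>i\<close>, so the coefficient at \<open>p\<close> is zero.
\<close>

lemma independent_conditions_Suc:
  assumes "S \<subseteq> proj_space n" and "independent_conditions n t S"
  shows "independent_conditions n (Suc t) S"
  unfolding independent_conditions_def
proof (intro allI impI ballI)
  fix c p
  assume c: "\<forall>g\<in>forms n (Suc t). (\<Sum>p\<in>S. c p * eval_at p g) = 0" and p: "p \<in> S"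
  from p assms(1) obtain i where i: "i \<le> n" "coords (representative p) i \<noteq> 0"
    by (metis linear_form_nonzero_coord representative_proj_space(1,2) subsetD)
  let ?z = "Poly_Mapping.single (Poly_Mapping.single i 1) 1 :: cpoly"
  have "(\<Sum>p\<in>S. (c p * coords (representative p) i) * eval_at p g) = 0"
    if g: "g \<in> forms n t" for g
  proof -
    have "?z * g \<in> forms n (Suc t)"
      using mult_in_forms[OF variable_in_forms[OF i(1)] g] by simp
    with c have "(\<Sum>p\<in>S. c p * eval_at p (?z * g)) = 0" by blast
    moreover have "eval_at p (?z * g) = coords (representative p) i * eval_at p g" for p
      by (simp only: eval_at_representative poly_eval_mult poly_eval_single monomial_at_variable
          mult_1)
    ultimately show ?thesis by (simp add: mult.assoc)
  qed
  with assms(2) p have "c p * coords (representative p) i = 0"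
    unfolding independent_conditions_def
    by (elim allE[of _ "\<lambda>p. c p * coords (representative p) i"]) blast
  with i(2) show "c p = 0" by simp
qed

lemma independent_conditions_mono:
  assumes "S \<subseteq> proj_space n" and "independent_conditions n s S" and "s \<le> t"
  shows "independent_conditions n t S"
  using assms(3,2) by (induction rule: dec_induct) (auto intro: independent_conditions_Suc[OF assms(1)])

text \<open>
  Both decompositions compute the same catalecticant pairing
  \<open>(g, h) \<mapsto> \<Sum>p\<in>S. b\<^sub>p g(p) h(p) = \<Sum>a\<in>A. c\<^sub>a g(a) h(a)\<close> between degrees \<open>s\<close> and \<open>t\<close>. The right hand
  expression puts every form vanishing on \<open>A\<close> into that kernel; the left hand one shows, by
  independence in degree \<open>t\<close>, that forms in the kernel vanish on \<open>S\<close>.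
\<close>

lemma vanishing_forms_subset_if_same_power_sum:
  assumes S: "S \<subseteq> proj_space n" and A: "A \<subseteq> proj_space n"
    and eq: "(\<Sum>p\<in>S. scale (b p) (representative p ^ (s + t))) =
      (\<Sum>a\<in>A. scale (c a) (representative a ^ (s + t)))"
    and nz: "\<forall>p\<in>S. b p \<noteq> 0"
    and indep: "independent_conditions n t S"
  shows "vanishing_forms n s A \<subseteq> vanishing_forms n s S"
proof
  fix g assume g: "g \<in> vanishing_forms n s A"
  have "(\<Sum>p\<in>S. (b p * eval_at p g) * eval_at p h) = 0" if h: "h \<in> forms n t" for h
  proof -
    have "g * h \<in> forms n (s + t)"
      using g h by (intro mult_in_forms) (auto simp: vanishing_forms_def)
    then have "(\<Sum>p\<in>S. b p * eval_at p (g * h)) = (\<Sum>a\<in>A. c a * eval_at a (g * h))"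
      unfolding eval_at_representative
      using S A representative_proj_space(1) by (intro power_sum_determines_evaluations[OF _ _ eq]) auto
    also have "\<dots> = 0"
      using g by (intro sum.neutral) (simp add: eval_at_representative poly_eval_mult vanishing_forms_def)
    finally show ?thesis
      by (simp add: eval_at_representative poly_eval_mult mult.assoc)
  qed
  with indep have "\<forall>p\<in>S. b p * eval_at p g = 0"
    unfolding independent_conditions_def
    by (elim allE[of _ "\<lambda>p. b p * eval_at p g"]) blast
  with nz g show "g \<in> vanishing_forms n s S" by (auto simp: vanishing_forms_def)
qed

theorem theorem1p2:
  fixes n d :: nat
    and f :: cpoly
    and q :: "cpoly set"
    and S A :: "cpoly set set"
  assumes "n \<ge> 1" and "d \<ge> 1"
    and "f \<in> forms n d" and "f \<noteq> 0" and "q = proj_class f"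
    and "finite S" and "S \<subseteq> proj_space n"
    and "minimally_spans d S q"
    and "card S < (n + d div 2) choose n"
    and "independent_conditions n (d div 2) S"
    and "finite A" and "A \<subseteq> proj_space n"
    and "card A = card S"
    and "q \<in> proj_span (veronese d ` A)"
  shows "vanishing_forms n (d div 2) A = vanishing_forms n (d div 2) S"
proof -
  let ?s = "d div 2" and ?t = "d - d div 2"
  note S = \<open>finite S\<close> \<open>S \<subseteq> proj_space n\<close> and A = \<open>finite A\<close> \<open>A \<subseteq> proj_space n\<close>
  have d: "?s + ?t = d" by simp
  obtain b where b: "f = (\<Sum>p\<in>S. scale (b p) (representative p ^ d))" "\<forall>p\<in>S. b p \<noteq> 0"
    using minimally_spans_obtain_nonzero_coefficients[OF \<open>f \<noteq> 0\<close> S] assms(5,8) by blast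
  obtain c where c: "f = (\<Sum>a\<in>A. scale (c a) (representative a ^ d))"
    using proj_class_in_span_veronese_iff[OF \<open>f \<noteq> 0\<close> A, of d] assms(5,14) by blast
  have "independent_conditions n ?t S"
    by (rule independent_conditions_mono[OF S(2) assms(10)]) linarith
  moreover have "(\<Sum>p\<in>S. scale (b p) (representative p ^ (?s + ?t))) =
      (\<Sum>a\<in>A. scale (c a) (representative a ^ (?s + ?t)))"
    unfolding d using b(1) c by (rule trans[OF sym])
  ultimately have le: "vanishing_forms n ?s A \<subseteq> vanishing_forms n ?s S"
    using vanishing_forms_subset_if_same_power_sum[OF S(2) A(2)] b(2) by blast
  have linear: "Vector_Spaces.linear scale (*) (eval_at p)" for p
    unfolding eval_at_representative[abs_def] by (rule linear_poly_eval)
  show ?thesis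
    unfolding vanishing_forms_def
  proof (rule cpoly.common_kernel_eq_if_independent[OF S(1) A(1) _ subspace_forms linear linear])
    show "card A \<le> card S" using \<open>card A = card S\<close> by simp
    show "\<forall>p\<in>S. c p = 0" if "\<forall>g\<in>forms n ?s. (\<Sum>p\<in>S. c p * eval_at p g) = 0" for c
      using assms(10) that unfolding independent_conditions_def by blast
  qed (use le in \<open>simp add: vanishing_forms_def\<close>)
qed

end
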